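(* Let $G=(V,E)$ be a finite connected undirected graph without loops. (1) Suppose that $V_1,V_2,\dots$ are edges of $G$ (each identified with the set of its two end vertices) and $U\subseteq V$ is a subset such that $$V=\Bigl(\bigsqcup_i \mathrm{Inf}\,V_i\Bigr)\sqcup U \qquad ( * )$$ is a decomposition of $G$ (with components given by the sets $\mathrm{Inf}\,V_i$ and the singletons $\{u\}$, $u\in U$), and such that both $U$ and $\bigl(\bigsqcup_i (\mathrm{Inf}\,V_i\setminus V_i)\bigr)\cup U$ are completely disconnected (possibly empty). Then $\{V_1,V_2,\dots\}$ is a maximal matching of $G$. (2) Conversely, if $\{V_1,V_2,\dots\}$ is a maximal matching of $G$, then the sets $\mathrm{Inf}\,V_i$ are pairwise disjoint and, with $U=V\setminus\bigsqcup_i\mathrm{Inf}\,V_i$, the expression $( * )$ is a decomposition of $G$ (with components given by the sets $\mathrm{Inf}\,V_i$ and the singletons $\{u\}$, $u\in U$) such that both $U$ and $\bigl(\bigsqcup_i (\mathrm{Inf}\,V_i\setminus V_i)\bigr)\cup U$ are completely disconnected (possibly empty).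
   Context: For a vertex $v$ of an undirected graph $G=(V,E)$, $\mathrm{D}(v)$ is the set of neighbours of $v$. The inflation of $U\subseteq V$ is $\mathrm{Inf}\,U=U\cup\{v\in V\mid \varnothing\ne \mathrm{D}(v)\subseteq U\}$; put $\mathrm{Inf}^0U=U$, $\mathrm{Inf}^{n}U=\mathrm{Inf}(\mathrm{Inf}^{n-1}U)$, and $\mathrm{Inf}^\infty U=\bigcup_{n\ge0}\mathrm{Inf}^nU$. A set is called a hyperinflation if it equals $\mathrm{Inf}^\infty U'$ for some $U'\subseteq V$. A decomposition of $G$ is a set of induced subgraphs $G_i=G[V_i']$ whose vertex sets $V_i'$ are hyperinflations and such that $V$ is the disjoint union of the $V_i'$. The symbol $\bigsqcup$ denotes a union of (pairwise) disjoint sets. A set of vertices is completely disconnected if no two of its vertices are adjacent. A matching is a set of edges no two of which have a common vertex; a matching is maximal if it is not properly contained in any other matching of $G$. The family $V_1,V_2,\dots$ may be empty. *)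

theory Defs
  imports "Graph_Theory.Digraph_Component" "HOL-Library.Disjoint_Sets"
begin

text \<open>
  As in \<open>Graph_Theory\<close>, a finite undirected graph without loops is a symmetric digraph (locale
  \<open>graph\<close>): every undirected edge is a pair of opposite arcs. In \<open>uedges\<close> the two
  arcs are merged again, so an undirected edge is the set of its two end vertices.
\<close>

definition uedges :: "('a, 'b) pre_digraph \<Rightarrow> 'a set set" where
  "uedges G = (\<lambda>e. {tail G e, head G e}) ` arcs G"

definition neighbours :: "('a, 'b) pre_digraph \<Rightarrow> 'a \<Rightarrow> 'a set" where
  "neighbours G v = {w. v \<rightarrow>\<^bsub>G\<^esub> w}"

definition inflation :: "('a, 'b) pre_digraph \<Rightarrow> 'a set \<Rightarrow> 'a set" where
  "inflation G U = U \<union> {v \<in> verts G. neighbours G v \<noteq> {} \<and> neighbours G v \<subseteq> U}"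

definition inflation_inf :: "('a, 'b) pre_digraph \<Rightarrow> 'a set \<Rightarrow> 'a set" where
  "inflation_inf G U = (\<Union>n. (inflation G ^^ n) U)"

definition hyperinflation :: "('a, 'b) pre_digraph \<Rightarrow> 'a set \<Rightarrow> bool" where
  "hyperinflation G W \<longleftrightarrow> (\<exists>U\<subseteq>verts G. W = inflation_inf G U)"

definition decomposition ::
    "('a, 'b) pre_digraph \<Rightarrow> ('a, 'b) pre_digraph set \<Rightarrow> bool" where
  "decomposition G Hs \<longleftrightarrow>
     (\<forall>H\<in>Hs. induced_subgraph H G \<and> hyperinflation G (verts H)) \<and>
     disjoint_family_on verts Hs \<and> verts G = (\<Union>H\<in>Hs. verts H)"

text \<open>
  The expression \<open>V = (\<Squnion>i. Inf V\<^sub>i) \<squnion> U\<close>, including the disjointness expressed by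
  \<open>\<squnion>\<close>, is a decomposition with components induced by the sets \<open>Inf V\<^sub>i\<close> and by
  the singletons of elements of \<open>U\<close>. Disjointness is required index-wise, since the set of
  components does not record repetitions in the family.
\<close>

definition inflation_decomposition ::
    "('a, 'b) pre_digraph \<Rightarrow> 'i set \<Rightarrow> ('i \<Rightarrow> 'a set) \<Rightarrow> 'a set \<Rightarrow> bool" where
  "inflation_decomposition G I F U \<longleftrightarrow>
     disjoint_family_on (\<lambda>i. inflation G (F i)) I \<and>
     (\<Union>i\<in>I. inflation G (F i)) \<inter> U = {} \<and>
     verts G = (\<Union>i\<in>I. inflation G (F i)) \<union> U \<and>
     decomposition G ((\<lambda>i. G \<restriction> inflation G (F i)) ` I \<union> (\<lambda>u. G \<restriction> {u}) ` U)"

definition completely_disconnected :: "('a, 'b) pre_digraph \<Rightarrow> 'a set \<Rightarrow> bool" where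
  "completely_disconnected G W \<longleftrightarrow> (\<forall>u\<in>W. \<forall>v\<in>W. \<not> u \<rightarrow>\<^bsub>G\<^esub> v)"

definition matching :: "('a, 'b) pre_digraph \<Rightarrow> 'a set set \<Rightarrow> bool" where
  "matching G M \<longleftrightarrow> M \<subseteq> uedges G \<and> disjoint M"

definition maximal_matching :: "('a, 'b) pre_digraph \<Rightarrow> 'a set set \<Rightarrow> bool" where
  "maximal_matching G M \<longleftrightarrow> matching G M \<and> (\<nexists>M'. matching G M' \<and> M \<subset> M')"

end

theory Submission
  imports Defs
begin

text \<open>
  A matching is maximal iff the set of vertices it leaves uncovered is completely disconnected.
  For a matching, the vertices that \<open>Inf V\<^sub>i\<close> adds to \<open>V\<^sub>i\<close> are
  uncovered: a vertex covered by another \<open>V\<^sub>j\<close> has a neighbour in \<open>V\<^sub>j\<close>,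
  hence outside \<open>V\<^sub>i\<close>. So the vertices added by the inflations together with \<open>U\<close>
  are exactly the uncovered ones. The inflations are stable, because a vertex adjacent to an added
  vertex already lies in \<open>V\<^sub>i\<close>, and so are the singletons of \<open>U\<close>, because
  a vertex whose only neighbour is uncovered would have to be uncovered too.
\<close>

lemma inflation_superset: "U \<subseteq> inflation G U"
  by (simp add: inflation_def)

text \<open>A stable set generates itself, since every iterate of the inflation returns it. One
  inflation step thus replaces the infinite union.\<close>

lemma inflation_fixpoint_hyperinflation:
  assumes "W \<subseteq> verts G" and "inflation G W = W"
  shows "hyperinflation G W"
proof -
  have "(inflation G ^^ n) W = W" for n
    using assms(2) by (induction n) auto
  then show ?thesis
    using assms(1) by (auto simp: hyperinflation_def inflation_inf_def)
qed

text \<open>Lets components be handled as plain vertex sets instead of subgraphs.\<close>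

lemma decomposition_induce_subgraph:
  assumes "wf_digraph G"
    and "\<And>W. W \<in> \<W> \<Longrightarrow> hyperinflation G W"
    and "disjoint \<W>" and "\<Union>\<W> = verts G"
  shows "decomposition G ((\<lambda>W. G \<restriction> W) ` \<W>)"
proof -
  have "induced_subgraph (G \<restriction> W) G" if "W \<in> \<W>" for W
    using that assms(4) by (intro wf_digraph.induced_induce[OF assms(1)]) blast
  \<comment> \<open>Distinct induced subgraphs come from distinct, hence disjoint, vertex
    sets.\<close>
  moreover have "disjoint_family_on verts ((\<lambda>W. G \<restriction> W) ` \<W>)"
    using assms(3) by (fastforce simp: disjoint_family_on_def disjoint_def)
  ultimately show ?thesis
    using assms(2,4) by (auto simp: decomposition_def)
qed

lemma uedges_iff: "e \<in> uedges G \<longleftrightarrow> (\<exists>u v. e = {u, v} \<and> u \<rightarrow>\<^bsub>G\<^esub> v)"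
  by (auto simp: uedges_def arcs_ends_conv)

lemma completely_disconnected_mono:
  "completely_disconnected G W \<Longrightarrow> W' \<subseteq> W \<Longrightarrow> completely_disconnected G W'"
  by (auto simp: completely_disconnected_def)

context sym_digraph
begin

lemma uedge_subset_verts: "e \<in> uedges G \<Longrightarrow> e \<subseteq> verts G"
  by (auto simp: uedges_def)

text \<open>The arc behind an edge has a direction; if \<open>v\<close> is its head, symmetry
  supplies the opposite arc.\<close>

lemma neighbour_in_uedge:
  assumes "e \<in> uedges G" and "v \<in> e"
  obtains w where "w \<in> e" and "w \<in> neighbours G v"
  using assms graph_symmetric by (auto simp: uedges_iff neighbours_def)

lemma inflation_subset_verts: "W \<subseteq> verts G \<Longrightarrow> inflation G W \<subseteq> verts G"
  by (auto simp: inflation_def)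

text \<open>A new edge can be adjoined to a matching exactly when both its ends are uncovered. This
  turns a statement about all larger matchings into a condition on pairs of vertices.\<close>

lemma maximal_matching_iff:
  "maximal_matching G M \<longleftrightarrow>
     matching G M \<and> completely_disconnected G (verts G - \<Union>M)"
proof (intro iffI conjI)
  assume max: "maximal_matching G M"
  then show M: "matching G M"
    by (simp add: maximal_matching_def)
  show "completely_disconnected G (verts G - \<Union>M)"
    unfolding completely_disconnected_def
  proof (intro ballI notI)
    fix u v assume uv: "u \<in> verts G - \<Union>M" "v \<in> verts G - \<Union>M" "u \<rightarrow>\<^bsub>G\<^esub> v"
    have "matching G (insert {u, v} M)"
      using M uv by (auto simp: matching_def uedges_iff disjoint_def)
    moreover have "M \<subset> insert {u, v} M"
      using uv by auto
    ultimately show False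
      using max by (auto simp: maximal_matching_def)
  qed
next
  assume *: "matching G M \<and> completely_disconnected G (verts G - \<Union>M)"
  have False if M': "matching G M'" "M \<subset> M'" for M'
  proof -
    obtain e where e: "e \<in> M'" "e \<notin> M"
      using M'(2) by blast
    have "e \<inter> e' = {}" if "e' \<in> M" for e'
    proof (rule disjointD)
      show "disjoint M'" "e' \<in> M'" "e \<noteq> e'"
        using M' e that by (auto simp: matching_def)
    qed (rule e(1))
    moreover have "e \<in> uedges G"
      using M'(1) e(1) by (auto simp: matching_def)
    ultimately show False
      using * uedge_subset_verts[of e]
      by (auto simp: uedges_iff completely_disconnected_def)
  qed
  with * show "maximal_matching G M"
    by (auto simp: maximal_matching_def)
qed

lemma inflation_uedge_idem:
  assumes "e \<in> uedges G"
  shows "inflation G (inflation G e) = inflation G e"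
proof
  show "inflation G (inflation G e) \<subseteq> inflation G e"
  proof
    fix v assume v: "v \<in> inflation G (inflation G e)"
    show "v \<in> inflation G e"
    proof (rule ccontr)
      assume notin: "v \<notin> inflation G e"
      \<comment> \<open>Only the outer inflation is unfolded: \<open>v\<close> is outside the inner
        one, so the outer one must have added it.\<close>
      with v have "v \<in> verts G" "neighbours G v \<noteq> {}" "neighbours G v \<subseteq> inflation G e"
        by (auto simp: inflation_def[of G "inflation G e"])
      moreover from this notin have "\<not> neighbours G v \<subseteq> e"
        by (simp add: inflation_def)
      ultimately obtain w where w: "w \<in> neighbours G v" "w \<in> inflation G e" "w \<notin> e"
        by blast
      \<comment> \<open>As \<open>w\<close> was added to \<open>e\<close>, all its neighbours lie in
        \<open>e\<close>; by symmetry \<open>v\<close> is one of them.\<close>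
      then have "v \<in> e"
        using graph_symmetric by (auto simp: inflation_def neighbours_def)
      with notin show False
        by (simp add: inflation_def)
    qed
  qed
qed (rule inflation_superset)

lemma matching_inflation_uncovered:
  assumes "matching G M" and "e \<in> M"
  shows "(inflation G e - e) \<inter> \<Union>M = {}"
proof (rule ccontr)
  assume "(inflation G e - e) \<inter> \<Union>M \<noteq> {}"
  then obtain v e' where v: "v \<in> inflation G e" "v \<notin> e" and e': "e' \<in> M" "v \<in> e'"
    by blast
  have "e' \<in> uedges G"
    using assms(1) e'(1) by (auto simp: matching_def)
  then obtain w where w: "w \<in> e'" "w \<in> neighbours G v"
    using e'(2) by (rule neighbour_in_uedge)
  \<comment> \<open>An added vertex has all its neighbours in \<open>e\<close>.\<close>
  with v have "w \<in> e"
    by (auto simp: inflation_def)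
  \<comment> \<open>The edges differ because \<open>v\<close> lies in \<open>e'\<close> but not in
    \<open>e\<close>.\<close>
  moreover have "e \<inter> e' = {}"
    using assms e' v(2) unfolding matching_def disjoint_def by blast
  ultimately show False
    using w(1) by blast
qed

lemma matching_inflation_disjoint:
  assumes "matching G M" and "e \<in> M" and "e' \<in> M" and "e \<noteq> e'"
  shows "inflation G e \<inter> inflation G e' = {}"
proof (rule ccontr)
  have disj: "e \<inter> e' = {}"
    using assms unfolding matching_def disjoint_def by blast
  assume "inflation G e \<inter> inflation G e' \<noteq> {}"
  then obtain v where v: "v \<in> inflation G e" "v \<in> inflation G e'"
    by blast
  \<comment> \<open>If \<open>v\<close> were in one of the edges, it would be a covered vertex added
    by the inflation of the other.\<close>
  have "v \<notin> e" "v \<notin> e'"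
    using v disj assms matching_inflation_uncovered[of M] by blast+
  \<comment> \<open>Now both inflations add \<open>v\<close>, so its neighbourhood lies in
    \<open>e \<inter> e'\<close> and is empty, while added vertices have at least one
    neighbour.\<close>
  with v disj show False
    by (auto simp: inflation_def)
qed

lemma inflation_uncovered_singleton:
  assumes "maximal_matching G M" and "u \<in> verts G" and "u \<notin> \<Union>M"
  shows "inflation G {u} = {u}"
proof (rule ccontr)
  assume "inflation G {u} \<noteq> {u}"
  then obtain v where v: "v \<in> verts G" "neighbours G v = {u}"
    by (auto simp: inflation_def)
  \<comment> \<open>The other end of an edge covering \<open>v\<close> could only be
    \<open>u\<close>, its sole neighbour, and \<open>u\<close> is uncovered.\<close>
  have "v \<notin> \<Union>M"
  proof
    assume "v \<in> \<Union>M"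
    then obtain e where e: "e \<in> M" "v \<in> e" by blast
    with assms(1) have "e \<in> uedges G"
      by (auto simp: maximal_matching_def matching_def)
    then obtain w where "w \<in> e" "w \<in> neighbours G v"
      using e(2) by (rule neighbour_in_uedge)
    with v e assms(3) show False by auto
  qed
  moreover have "v \<rightarrow>\<^bsub>G\<^esub> u"
    using v(2) by (auto simp: neighbours_def)
  ultimately show False
    using assms v(1) by (auto simp: maximal_matching_iff completely_disconnected_def)
qed

lemma inflation_decomposition_maximal_matching:
  assumes "\<And>i. i \<in> I \<Longrightarrow> F i \<in> uedges G"
    and decomp: "inflation_decomposition G I F U"
    and cd: "completely_disconnected G ((\<Union>i\<in>I. inflation G (F i) - F i) \<union> U)"
  shows "maximal_matching G (F ` I)"
  unfolding maximal_matching_iff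
proof
  have "disjoint_family_on (\<lambda>i. inflation G (F i)) I"
    using decomp by (simp add: inflation_decomposition_def)
  \<comment> \<open>Disjointness passes from the inflations down to the edges they contain.\<close>
  then have "F i \<inter> F j = {}" if "i \<in> I" "j \<in> I" "i \<noteq> j" for i j
    using that inflation_superset[of "F i" G] inflation_superset[of "F j" G]
    unfolding disjoint_family_on_def by blast
  then have "disjoint (F ` I)"
    unfolding disjoint_def by blast
  then show "matching G (F ` I)"
    using assms(1) by (auto simp: matching_def)
  have "verts G = (\<Union>i\<in>I. inflation G (F i)) \<union> U"
    using decomp by (simp add: inflation_decomposition_def)
  \<comment> \<open>An uncovered vertex lies in \<open>U\<close> or was added by some inflation, so
    disconnectedness descends to the uncovered vertices.\<close>
  then have "verts G - \<Union>(F ` I) \<subseteq> (\<Union>i\<in>I. inflation G (F i) - F i) \<union> U"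
    by blast
  with cd show "completely_disconnected G (verts G - \<Union>(F ` I))"
    by (rule completely_disconnected_mono)
qed

lemma maximal_matching_inflation_decomposition:
  assumes inj: "inj_on F I" and max: "maximal_matching G (F ` I)"
  defines "U \<equiv> verts G - (\<Union>i\<in>I. inflation G (F i))"
  shows "inflation_decomposition G I F U"
    and "completely_disconnected G ((\<Union>i\<in>I. inflation G (F i) - F i) \<union> U)"
proof -
  have M: "matching G (F ` I)"
    and cd: "completely_disconnected G (verts G - \<Union>(F ` I))"
    using max by (simp_all add: maximal_matching_iff)
  have edge: "F i \<in> uedges G" if "i \<in> I" for i
    using M that by (auto simp: matching_def)
  have sub: "inflation G (F i) \<subseteq> verts G" if "i \<in> I" for i
    using edge[OF that] by (intro inflation_subset_verts uedge_subset_verts)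
  have disj: "inflation G (F i) \<inter> inflation G (F j) = {}"
    if "i \<in> I" "j \<in> I" "i \<noteq> j" for i j
    using that inj by (intro matching_inflation_disjoint[OF M]) (auto dest: inj_onD)
  have U: "U \<inter> \<Union>(F ` I) = {}"
    unfolding U_def using inflation_superset[of _ G] by blast

  \<comment> \<open>The vertex sets of the intended components: inflated edges are stable for any
    matching, the singletons by maximality.\<close>
  let ?\<W> = "(\<lambda>i. inflation G (F i)) ` I \<union> (\<lambda>u. {u}) ` U"
  have "hyperinflation G W" if "W \<in> ?\<W>" for W
    using that
  proof
    assume "W \<in> (\<lambda>i. inflation G (F i)) ` I"
    then show ?thesis
      using sub edge
      by (auto intro!: inflation_fixpoint_hyperinflation inflation_uedge_idem)
  next
    assume "W \<in> (\<lambda>u. {u}) ` U"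
    then obtain u where u: "u \<in> U" "W = {u}" by blast
    have "inflation G {u} = {u}"
      using u U by (intro inflation_uncovered_singleton[OF max]) (auto simp: U_def)
    with u show ?thesis
      by (auto simp: U_def intro!: inflation_fixpoint_hyperinflation)
  qed
  moreover have "disjoint ?\<W>"
  proof (rule disjoint_union)
    show "disjoint ((\<lambda>i. inflation G (F i)) ` I)"
      unfolding disjoint_def using disj by blast
  qed (auto simp: disjoint_def U_def)
  moreover have "\<Union>?\<W> = verts G"
    using sub by (auto simp: U_def)
  ultimately have "decomposition G ((\<lambda>W. G \<restriction> W) ` ?\<W>)"
    by (rule decomposition_induce_subgraph[OF wf_digraph])
  then show "inflation_decomposition G I F U"
    using disj sub
    by (auto simp: inflation_decomposition_def disjoint_family_on_def image_Un image_image U_def)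

  \<comment> \<open>The reverse of the inclusion used in the other direction: added vertices and
    \<open>U\<close> are all uncovered.\<close>
  have "(\<Union>i\<in>I. inflation G (F i) - F i) \<union> U \<subseteq> verts G - \<Union>(F ` I)"
  proof (intro Un_least UN_least)
    show "inflation G (F i) - F i \<subseteq> verts G - \<Union>(F ` I)" if "i \<in> I" for i
      using that matching_inflation_uncovered[OF M, of "F i"] sub[of i] by blast
    show "U \<subseteq> verts G - \<Union>(F ` I)"
      using U unfolding U_def by blast
  qed
  with cd show "completely_disconnected G ((\<Union>i\<in>I. inflation G (F i) - F i) \<union> U)"
    by (rule completely_disconnected_mono)
qed

end

theorem theorem3p1:
  fixes G :: "('a, 'b) pre_digraph"
    and I :: "'i set"
    and F :: "'i \<Rightarrow> 'a set"
  assumes "graph G" and "connected G"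
  shows
    "(\<forall>U. (\<forall>i\<in>I. F i \<in> uedges G) \<and> U \<subseteq> verts G \<and>
          inflation_decomposition G I F U \<and>
          completely_disconnected G U \<and>
          completely_disconnected G ((\<Union>i\<in>I. inflation G (F i) - F i) \<union> U)
        \<longrightarrow> maximal_matching G (F ` I)) \<and>
     (inj_on F I \<and> maximal_matching G (F ` I) \<longrightarrow>
        disjoint_family_on (\<lambda>i. inflation G (F i)) I \<and>
        (let U = verts G - (\<Union>i\<in>I. inflation G (F i)) in
          inflation_decomposition G I F U \<and>
          completely_disconnected G U \<and>
          completely_disconnected G ((\<Union>i\<in>I. inflation G (F i) - F i) \<union> U)))"
proof -
  interpret graph G by fact
  show ?thesis
    unfolding Let_def
  proof (intro conjI allI impI; elim conjE)
    fix U assume "\<forall>i\<in>I. F i \<in> uedges G" "inflation_decomposition G I F U"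
      "completely_disconnected G ((\<Union>i\<in>I. inflation G (F i) - F i) \<union> U)"
    then show "maximal_matching G (F ` I)"
      by (intro inflation_decomposition_maximal_matching) auto
  next
    let ?U = "verts G - (\<Union>i\<in>I. inflation G (F i))"
    assume "inj_on F I" "maximal_matching G (F ` I)"
    note * = maximal_matching_inflation_decomposition[OF this]
    show "inflation_decomposition G I F ?U"
      and "completely_disconnected G ((\<Union>i\<in>I. inflation G (F i) - F i) \<union> ?U)"
      by (fact *)+
    show "completely_disconnected G ?U"
      using *(2) by (rule completely_disconnected_mono) blast
    show "disjoint_family_on (\<lambda>i. inflation G (F i)) I"
      using *(1) by (simp add: inflation_decomposition_def)
  qed
qed

end
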